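(* For every integer $n\ge 0$, among all the unpaired parts in the partitions of $5n+4$, the number of parts congruent to $1$ modulo $4$ minus the number congruent to $3$ modulo $4$ is divisible by $5$; that is, $$\sum_{\lambda\vdash 5n+4}\bigl(c_1(\lambda)-c_3(\lambda)\bigr)\equiv 0\pmod 5 .$$
   Context: For an integer partition $\lambda$, pair equal parts as far as possible; the unpaired parts of $\lambda$ are the part sizes occurring with odd multiplicity, each taken once. For $i\in\{1,3\}$, $c_i(\lambda)$ is the number of unpaired parts of $\lambda$ congruent to $i$ modulo $4$. The notation $\lambda\vdash N$ means that $\lambda$ is a partition of $N$. *)

theory Defs
  imports "HOL-Library.Multiset" "HOL-Number_Theory.Cong"
begin

definition integer_partitions :: "nat \<Rightarrow> nat multiset set" where
  "integer_partitions N = {p. 0 \<notin># p \<and> sum_mset p = N}"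

definition unpaired_parts :: "nat multiset \<Rightarrow> nat set" where
  "unpaired_parts p = {k. k \<in># p \<and> odd (count p k)}"

definition unpaired_count :: "nat \<Rightarrow> nat multiset \<Rightarrow> nat" where
  "unpaired_count i p = card {k \<in> unpaired_parts p. [k = i] (mod 4)}"

(* Finiteness matters: a sum over an infinite index set would be 0 by convention. *)

lemma size_le_sum_mset: "0 \<notin># M \<Longrightarrow> size M \<le> sum_mset (M :: nat multiset)"
  by (induction M) auto

lemma finite_integer_partitions: "finite (integer_partitions N)"
proof (rule finite_subset)
  show "integer_partitions N \<subseteq> mset ` {xs. set xs \<subseteq> {..N} \<and> length xs \<le> N}"
  proof
    fix M assume M: "M \<in> integer_partitions N"
    obtain xs where xs: "M = mset xs"
      by (metis ex_mset)
    have "x \<le> N" if "x \<in># M" for x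
      using M that by (auto simp: integer_partitions_def dest!: multi_member_split)
    moreover have "size M \<le> N"
      using M size_le_sum_mset by (auto simp: integer_partitions_def)
    ultimately show "M \<in> mset ` {xs. set xs \<subseteq> {..N} \<and> length xs \<le> N}"
      using xs by auto
  qed
  show "finite (mset ` {xs. set xs \<subseteq> {..N} \<and> length xs \<le> N})"
    by (intro finite_imageI finite_lists_length_le) simp
qed

end

theory Submission
  imports Defs "HOL-Library.Nat_Bijection" "HOL-Computational_Algebra.Formal_Power_Series"
begin

text \<open>
Removing one copy of \<open>k\<close> shows that the partitions in which \<open>k\<close> occurs an odd number of times are
counted by \<open>P q\<^sup>k / (1 + q\<^sup>k)\<close>, where \<open>P\<close> is the partition generating function. So the sum in question has
the generating function \<open>F = P L\<close> with \<open>L = \<Sum> \<chi>(k) q\<^sup>k / (1 + q\<^sup>k)\<close> and \<open>\<chi>\<close> the nontrivial character modulo 4.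
Write \<open>E = \<Prod> (1 - q\<^sup>i)\<close> and \<open>R = \<Prod> (1 + q\<^sup>i)\<close>, so that \<open>P = 1 / E\<close> and \<open>E R = E(q\<^sup>2)\<close>. Rearranging the double
series gives \<open>1 - 4 L = 1 + 4 \<Sum> (-1)\<^sup>k q\<^bsup>T k\<^esup> / (1 + q\<^sup>k)\<close> with the triangular numbers \<open>T k\<close>, and this is
\<open>E\<^sup>2 / R\<^sup>2\<close>. Hence \<open>4 F = P - E / R\<^sup>2\<close>. Multiplied by \<open>(E R)\<^sup>5\<close>, which is a series in \<open>q\<^sup>5\<close> modulo 5, the
two terms become \<open>E R\<^sup>2 (E R)\<^sup>3\<close> and \<open>E\<^sup>3 (E R)\<^sup>3\<close>. By Gauss, \<open>E R\<^sup>2 = \<Sum> q\<^bsup>T k\<^esup>\<close>, and by Jacobi,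
\<open>E\<^sup>3 = \<Sum> (-1)\<^sup>k (2 k + 1) q\<^bsup>T k\<^esup>\<close>, so the exponents of both products are of the form \<open>T j + 2 T k\<close> with a weight
divisible by \<open>2 k + 1\<close>. As \<open>8 (T j + 2 T k) + 3 = (2 j + 1)\<^sup>2 + 2 (2 k + 1)\<^sup>2\<close> and \<open>-2\<close> is not a square modulo 5,
an exponent congruent to 4 modulo 5 forces 5 to divide \<open>2 k + 1\<close>.
\<close>

unbundle fps_syntax

section \<open>Finite forms of the theta identities\<close>

text \<open>Inductive step of \<open>psi_telescope\<close> as a polynomial identity: with
  \<open>n = Suc K + j\<close>, read \<open>N\<close>, \<open>a\<close>, \<open>b\<close> as the
  powers of \<open>q\<close> with exponents \<open>n\<close>, \<open>K\<close>, \<open>j\<close>,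
  \<open>t\<close> as \<open>q ^ triangle K\<close> and \<open>u\<close> as the pair of reciprocals
  for \<open>K + 1\<close>.\<close>

lemma psi_step:
  fixes q :: "'a::idom"
  assumes "N = q * a * b"
  shows "- (N * (1 - q * a) * t * (u * (1 - N * a * q\<^sup>2)))
      + t * (a * q) * u * ((1 - N\<^sup>2 * q) * (1 - N) - (1 + N) * (1 - b) * (1 - N * a * q\<^sup>2))
    = - (N * (1 - q\<^sup>2 * a) * (t * (a * q)) * ((1 - b) * u))"
  unfolding assms by (simp add: algebra_simps power2_eq_square)

text \<open>Same reading for \<open>jacobi_telescope\<close>, with \<open>e\<close> the sign
  \<open>(-1) ^ K\<close> and \<open>c\<close> the weight \<open>2 * K + 1\<close>.\<close>

lemma jacobi_step:
  fixes q :: "'a::idom"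
  assumes "N = q * a * b"
  shows "e * t * N * ((1 - N) * (c + 2 + c * (q * a)) + 2 * N * (1 - q * a)) * (u * (1 - N * a * q\<^sup>2))
      + - e * (c + 2) * (t * (a * q)) * u
        * ((1 - N\<^sup>2 * q) * (1 + N) - (1 - N) * (1 - b) * (1 - N * a * q\<^sup>2)) * (1 - N)
    = - e * (t * (a * q)) * N * ((1 - N) * (c + 4 + (c + 2) * (q\<^sup>2 * a)) + 2 * N * (1 - q\<^sup>2 * a))
        * ((1 - b) * u)"
proof -
  have "N * ((1 - N) * (c + 2 + c * (q * a)) + 2 * N * (1 - q * a)) * (1 - N * a * q\<^sup>2)
      - (c + 2) * (a * q)
        * ((1 - N\<^sup>2 * q) * (1 + N) - (1 - N) * (1 - b) * (1 - N * a * q\<^sup>2)) * (1 - N)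
    = - (a * q) * N * ((1 - N) * (c + 4 + (c + 2) * (q\<^sup>2 * a)) + 2 * N * (1 - q\<^sup>2 * a)) * (1 - b)"
    unfolding assms by (simp add: algebra_simps power2_eq_square)
  \<comment> \<open>The common factor \<open>e * t * u\<close> is restored with the large factors
    kept opaque, so only the identity above has to be expanded.\<close>
  moreover have "e * t * N * A * (u * B) + - e * c' * (t * d) * u * C * M = - e * (t * d) * N * D * (b' * u)"
    if "N * A * B - c' * d * C * M = - d * N * D * b'" for A B c' d C M D b' :: 'a
    using arg_cong[OF that, of "\<lambda>x. e * t * u * x"] by (simp add: algebra_simps)
  ultimately show ?thesis
    by blast
qed

lemma crank_step:
  fixes q :: "'a::idom"
  assumes "N = q * a * b"
  shows "e * t * (u * (1 - N * a * q)) + (1 - N) * (- e * t * (1 + q * a) * u)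
    = - e * (t * (a * q)) * ((1 - b) * u)"
  unfolding assms by (simp add: algebra_simps)

lemma eq_0_if_mult_eq_0:
  fixes x :: "'a::idom"
  assumes "x * c = 0" and "c \<noteq> 0"
  shows "x = 0"
  using assms by simp

lemma sum_mult_diff:
  fixes \<alpha> \<beta> :: "'a::comm_ring_1"
  shows "(\<Sum>k\<in>A. f k * (\<alpha> - \<beta> * a k * b k)) = \<alpha> * (\<Sum>k\<in>A. f k) - \<beta> * (\<Sum>k\<in>A. f k * (a k * b k))"
  by (simp add: sum_distrib_left sum_subtractf algebra_simps)

text \<open>\<open>P m\<close> is the reciprocal of \<open>(1 - q) * ... * (1 - q ^ m)\<close>.
  Hence \<open>P (n - k) * P (Suc (k + n))\<close> is, up to the factor
  \<open>P (2 * n + 1)\<close>, the Gaussian binomial coefficient of \<open>2 * n + 1\<close> over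
  \<open>n - k\<close>.\<close>

locale q_reciprocals =
  fixes q :: "'a::idom" and P :: "nat \<Rightarrow> 'a"
  assumes not_root_of_unity: "q ^ Suc m \<noteq> 1"
    and P_0: "P 0 = 1"
    and P_Suc: "P (Suc m) * (1 - q ^ Suc m) = P m"
begin

text \<open>Turns the boundary term at \<open>K\<close> into a multiple of the weight at
  \<open>K + 1\<close>, so that the next summand can be added to it.\<close>

lemma P_pair:
  assumes "n = Suc K + j"
  shows "(1 - q ^ (n - K)) * (P (n - K) * P (m + n)) = P (n - Suc K) * P (Suc (m + n)) * (1 - q ^ Suc (m + n))"
proof -
  have *: "n - K = Suc (n - Suc K)"
    using assms by auto
  have "(1 - q ^ (n - K)) * (P (n - K) * P (m + n)) = P (n - K) * (1 - q ^ (n - K)) * P (m + n)"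
    by (simp only: mult_ac)
  also have "\<dots> = P (n - Suc K) * (P (Suc (m + n)) * (1 - q ^ Suc (m + n)))"
    unfolding * P_Suc ..
  finally show ?thesis
    by (simp only: mult_ac)
qed

text \<open>
The finite sums satisfy first-order recurrences in \<open>n\<close>, found with telescoping certificates: applied
to the summand, the recurrence has closed partial sums, which vanish at \<open>K = n\<close> because of the
factor \<open>1 - q ^ (n - K)\<close>.
\<close>

lemma psi_telescope:
  assumes "K \<le> n"
  shows "(\<Sum>k\<le>K. q ^ triangle k * (P (n - k) * P (Suc (k + n))) *
      ((1 - q ^ (2 * n + 1)) * (1 - q ^ n) - (1 + q ^ n) * (1 - q ^ (n - k)) * (1 - q ^ Suc (k + n))))
    = - (q ^ n * (1 - q ^ Suc K) * q ^ triangle K * ((1 - q ^ (n - K)) * (P (n - K) * P (Suc (K + n)))))"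
  using assms
proof (induction K)
  case 0
  define N where "N = q ^ n"
  have "q ^ (n * 2) = N * N"
    by (simp add: N_def power_mult power2_eq_square)
  then show ?case by (simp add: algebra_simps flip: N_def)
next
  case (Suc K)
  then obtain j where n: "n = Suc K + j" by (auto dest: le_Suc_ex)
  have "K \<le> n" using Suc by simp
  have N: "q ^ n = q * q ^ K * q ^ j"
    by (simp add: n power_add)
  have pair: "(1 - q ^ (n - K)) * (P (n - K) * P (Suc (K + n)))
      = P (n - Suc K) * P (Suc (Suc K + n)) * (1 - q ^ Suc (Suc K + n))"
    using P_pair[OF n, of "Suc K"] by (simp only: add_Suc)
  have d: "q ^ (2 * n + 1) = (q ^ n)\<^sup>2 * q"
    by (simp only: mult.commute[of 2 n] power_add power_mult power_one_right)
  have p: "q ^ (n - Suc K) = q ^ j"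
    "q ^ Suc (Suc K + n) = q ^ n * q ^ K * q\<^sup>2" "q ^ Suc (Suc K) = q\<^sup>2 * q ^ K"
    "q ^ Suc K = q * q ^ K" "q ^ triangle (Suc K) = q ^ triangle K * (q ^ K * q)"
    by (simp_all add: n power_add power2_eq_square mult_2 mult_ac)
  show ?case
    using psi_step[OF N, of "q ^ triangle K" "P (n - Suc K) * P (Suc (Suc K + n))"]
    unfolding sum.atMost_Suc Suc.IH[OF \<open>K \<le> n\<close>]
      pair
    unfolding d p .
qed

text \<open>The rational certificate has denominator \<open>1 - q ^ n\<close>; the extra factor on
  the left clears it.\<close>

lemma jacobi_telescope:
  assumes "K \<le> n"
  shows "(\<Sum>k\<le>K. (-1) ^ k * of_nat (2 * k + 1) * q ^ triangle k * (P (n - k) * P (Suc (k + n))) *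
      ((1 - q ^ (2 * n + 1)) * (1 + q ^ n) - (1 - q ^ n) * (1 - q ^ (n - k)) * (1 - q ^ Suc (k + n))))
      * (1 - q ^ n)
    = (-1) ^ K * q ^ triangle K * q ^ n *
      ((1 - q ^ n) * (of_nat (2 * K + 1) + 2 + of_nat (2 * K + 1) * q ^ Suc K) + 2 * q ^ n * (1 - q ^ Suc K))
      * ((1 - q ^ (n - K)) * (P (n - K) * P (Suc (K + n))))"
  using assms
proof (induction K)
  case 0
  define N where "N = q ^ n"
  have "q ^ (n * 2) = N * N"
    by (simp add: N_def power_mult power2_eq_square)
  then show ?case by (simp add: algebra_simps flip: N_def)
next
  case (Suc K)
  then obtain j where n: "n = Suc K + j" by (auto dest: le_Suc_ex)
  have "K \<le> n" using Suc by simp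
  have N: "q ^ n = q * q ^ K * q ^ j"
    by (simp add: n power_add)
  have pair: "(1 - q ^ (n - K)) * (P (n - K) * P (Suc (K + n)))
      = P (n - Suc K) * P (Suc (Suc K + n)) * (1 - q ^ Suc (Suc K + n))"
    using P_pair[OF n, of "Suc K"] by (simp only: add_Suc)
  have d: "q ^ (2 * n + 1) = (q ^ n)\<^sup>2 * q"
    by (simp only: mult.commute[of 2 n] power_add power_mult power_one_right)
  have p: "q ^ (n - Suc K) = q ^ j"
    "q ^ Suc (Suc K + n) = q ^ n * q ^ K * q\<^sup>2" "q ^ Suc (Suc K) = q\<^sup>2 * q ^ K"
    "q ^ Suc K = q * q ^ K" "q ^ triangle (Suc K) = q ^ triangle K * (q ^ K * q)"
    "(-1) ^ Suc K = - ((-1) ^ K :: 'a)"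
    "of_nat (2 * Suc K + 1) = (of_nat (2 * K + 1) + 2 :: 'a)"
    "of_nat (2 * K + 1) + 2 + 2 = (of_nat (2 * K + 1) + 4 :: 'a)"
    by (simp_all add: n power_add power2_eq_square mult_2 mult_ac)
  show ?case
    using jacobi_step[OF N, of "(-1) ^ K" "q ^ triangle K" "of_nat (2 * K + 1)"
        "P (n - Suc K) * P (Suc (Suc K + n))"]
    unfolding sum.atMost_Suc distrib_right[of _ _ "1 - q ^ n"] Suc.IH[OF \<open>K \<le> n\<close>]
      pair
    unfolding d p .
qed

text \<open>The summand joins the indices \<open>k\<close> and \<open>-k\<close> of a bilateral sum
  with terms \<open>(-1)^k q^(k(k-1)/2)\<close>. For \<open>0 < n\<close> and \<open>K = n\<close>
  the bracket vanishes, which is the q-binomial theorem for a product with a zero factor.\<close>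

lemma crank_telescope:
  assumes "K \<le> n"
  shows "(1 - q ^ n) * (P n * P n
      + (\<Sum>k=1..K. (-1) ^ k * q ^ triangle (k - 1) * (1 + q ^ k) * (P (n - k) * P (k + n))))
    = (-1) ^ K * q ^ triangle K * ((1 - q ^ (n - K)) * (P (n - K) * P (K + n)))"
  using assms
proof (induction K)
  case 0
  show ?case by (simp add: algebra_simps)
next
  case (Suc K)
  then obtain j where n: "n = Suc K + j" by (auto dest: le_Suc_ex)
  have "K \<le> n" using Suc by simp
  have N: "q ^ n = q * q ^ K * q ^ j"
    by (simp add: n power_add)
  have p: "q ^ (n - Suc K) = q ^ j" "q ^ Suc (K + n) = q ^ n * q ^ K * q"
    "q ^ Suc K = q * q ^ K" "q ^ triangle (Suc K) = q ^ triangle K * (q ^ K * q)"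
    "(-1) ^ Suc K = - ((-1) ^ K :: 'a)" "Suc K - 1 = K" "Suc K + n = Suc (K + n)"
    by (simp_all add: n power_add power2_eq_square mult_2 mult_ac)
  have s: "(1 - q ^ n) * (x + sum f {1..Suc K}) = (1 - q ^ n) * (x + sum f {1..K}) + (1 - q ^ n) * f (Suc K)"
    for x and f :: "nat \<Rightarrow> 'a"
    by (simp add: algebra_simps)
  show ?case
    using crank_step[OF N, of "(-1) ^ K" "q ^ triangle K" "P (n - Suc K) * P (Suc (K + n))"]
    unfolding s Suc.IH[OF \<open>K \<le> n\<close>] P_pair[OF n, of K] p .
qed


section \<open>Evaluation of the finite sums\<close>

lemma one_minus_power_neq_0 [simp]: "0 < m \<Longrightarrow> 1 - q ^ m \<noteq> 0"
  using not_root_of_unity[of "m - 1"] by simp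

text \<open>The two extra factors lower both indices of \<open>P\<close> by one and kill the term
  \<open>k = Suc n\<close>. This turns a telescoped identity into a recurrence between the sums for
  \<open>Suc n\<close> and \<open>n\<close>.\<close>

lemma sum_P_pair_pred:
  "(\<Sum>k\<le>Suc n. f k * (P (Suc n - k) * P (Suc (k + Suc n))) * ((1 - q ^ (Suc n - k)) * (1 - q ^ Suc (k + Suc n))))
    = (\<Sum>k\<le>n. f k * (P (n - k) * P (Suc (k + n))))"
proof -
  have "f k * (P (Suc n - k) * P (Suc (k + Suc n))) * ((1 - q ^ (Suc n - k)) * (1 - q ^ Suc (k + Suc n)))
      = f k * (P (n - k) * P (Suc (k + n)))" if "k \<le> n" for k
  proof -
    have "P (Suc n - k) * (1 - q ^ (Suc n - k)) = P (n - k)"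
      using P_Suc[of "n - k"] that by (simp add: Suc_diff_le)
    moreover have "P (Suc (k + Suc n)) * (1 - q ^ Suc (k + Suc n)) = P (Suc (k + n))"
      using P_Suc[of "k + Suc n"] by simp
    moreover have "c * (x * y) * (a * b) = c * ((x * a) * (y * b))" for a b c x y :: 'a
      by (simp only: mult_ac)
    ultimately show ?thesis
      by (simp only:)
  qed
  then have "(\<Sum>k\<le>n. f k * (P (Suc n - k) * P (Suc (k + Suc n))) * ((1 - q ^ (Suc n - k)) * (1 - q ^ Suc (k + Suc n))))
    = (\<Sum>k\<le>n. f k * (P (n - k) * P (Suc (k + n))))"
    by (intro sum.cong refl) (simp only: atMost_iff)
  moreover have "(\<Sum>k\<le>Suc n. h k * ((1 - q ^ (Suc n - k)) * (1 - q ^ Suc (k + Suc n))))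
      = (\<Sum>k\<le>n. h k * ((1 - q ^ (Suc n - k)) * (1 - q ^ Suc (k + Suc n))))" for h
    by simp
  ultimately show ?thesis
    by (simp only:)
qed

lemma P_odd_step:
  "P (2 * Suc n + 1) * (1 - q ^ (2 * Suc n + 1)) * ((1 - q ^ Suc n) * (1 + q ^ Suc n)) = P (2 * n + 1)"
proof -
  have "(1 - q ^ Suc n) * (1 + q ^ Suc n) = 1 - q ^ (2 * Suc n)"
    by (simp only: mult.commute[of 2 "Suc n"] power_mult) (simp add: algebra_simps power2_eq_square)
  then show ?thesis
    using P_Suc[of "2 * Suc n"] P_Suc[of "2 * n + 1"] by simp
qed

text \<open>Finite form of Gauss's identity: in the limit every \<open>P\<close> becomes 1/E,
  leaving E R^2 for the theta series. With \<open>m = Suc n\<close>, both sides satisfy the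
  recurrence with factors \<open>(1 - q ^ (2 * m + 1)) * (1 - q ^ m)\<close> and
  \<open>1 + q ^ m\<close>.\<close>

lemma psi_finite:
  "(\<Sum>k\<le>n. q ^ triangle k * (P (n - k) * P (Suc (k + n)))) = P (2 * n + 1) * (\<Prod>i=1..n. 1 + q ^ i)\<^sup>2"
proof (induction n)
  case 0
  show ?case by (simp add: P_0)
next
  case (Suc n)
  let ?m = "Suc n"
  let ?A = "\<lambda>n. \<Sum>k\<le>n. q ^ triangle k * (P (n - k) * P (Suc (k + n)))"
  have "(\<Sum>k\<le>?m. q ^ triangle k * (P (?m - k) * P (Suc (k + ?m))) *
      ((1 - q ^ (2 * ?m + 1)) * (1 - q ^ ?m) - (1 + q ^ ?m) * (1 - q ^ (?m - k)) * (1 - q ^ Suc (k + ?m)))) = 0"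
    by (subst psi_telescope) auto
  also have "(\<Sum>k\<le>?m. q ^ triangle k * (P (?m - k) * P (Suc (k + ?m))) *
      ((1 - q ^ (2 * ?m + 1)) * (1 - q ^ ?m) - (1 + q ^ ?m) * (1 - q ^ (?m - k)) * (1 - q ^ Suc (k + ?m))))
    = (1 - q ^ (2 * ?m + 1)) * (1 - q ^ ?m) * ?A ?m - (1 + q ^ ?m) * ?A n"
    by (simp only: sum_mult_diff sum_P_pair_pred)
  finally have *: "(1 - q ^ (2 * ?m + 1)) * (1 - q ^ ?m) * ?A ?m = (1 + q ^ ?m) * ?A n"
    by simp
  have "((1 - q ^ (2 * ?m + 1)) * (1 - q ^ ?m)) * ?A ?m
      = ((1 - q ^ (2 * ?m + 1)) * (1 - q ^ ?m)) * (P (2 * ?m + 1) * (\<Prod>i=1..?m. 1 + q ^ i)\<^sup>2)"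
    unfolding * Suc.IH P_odd_step[of n, symmetric] prod.cl_ivl_Suc power2_eq_square
    by (simp add: mult_ac)
  moreover have nz: "1 - q ^ (2 * ?m + 1) \<noteq> 0" "1 - q ^ ?m \<noteq> 0"
    by (rule one_minus_power_neq_0; simp)+
  ultimately show ?case
    using mult_left_cancel[OF no_zero_divisors[OF nz]] by blast
qed

text \<open>Finite form of Jacobi's identity, whose limit is E^3. The recurrence is the one for
  Gauss's identity with the signs in \<open>1 - q ^ m\<close> and \<open>1 + q ^ m\<close>
  exchanged.\<close>

lemma jacobi_finite:
  "(\<Sum>k\<le>n. (-1) ^ k * of_nat (2 * k + 1) * q ^ triangle k * (P (n - k) * P (Suc (k + n))))
    = P (2 * n + 1) * (\<Prod>i=1..n. 1 - q ^ i)\<^sup>2"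
proof (induction n)
  case 0
  show ?case by (simp add: P_0)
next
  case (Suc n)
  let ?m = "Suc n"
  let ?c = "\<lambda>k. (-1) ^ k * of_nat (2 * k + 1) * q ^ triangle k"
  let ?B = "\<lambda>n. \<Sum>k\<le>n. ?c k * (P (n - k) * P (Suc (k + n)))"
  have "(\<Sum>k\<le>?m. ?c k * (P (?m - k) * P (Suc (k + ?m))) *
      ((1 - q ^ (2 * ?m + 1)) * (1 + q ^ ?m) - (1 - q ^ ?m) * (1 - q ^ (?m - k)) * (1 - q ^ Suc (k + ?m))))
      * (1 - q ^ ?m) = 0"
    by (subst jacobi_telescope) auto
  then have "(\<Sum>k\<le>?m. ?c k * (P (?m - k) * P (Suc (k + ?m))) *
      ((1 - q ^ (2 * ?m + 1)) * (1 + q ^ ?m) - (1 - q ^ ?m) * (1 - q ^ (?m - k)) * (1 - q ^ Suc (k + ?m)))) = 0"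
    by (rule eq_0_if_mult_eq_0) (rule one_minus_power_neq_0, simp)
  also have "(\<Sum>k\<le>?m. ?c k * (P (?m - k) * P (Suc (k + ?m))) *
      ((1 - q ^ (2 * ?m + 1)) * (1 + q ^ ?m) - (1 - q ^ ?m) * (1 - q ^ (?m - k)) * (1 - q ^ Suc (k + ?m))))
    = (1 - q ^ (2 * ?m + 1)) * (1 + q ^ ?m) * ?B ?m - (1 - q ^ ?m) * ?B n"
    by (simp only: sum_mult_diff sum_P_pair_pred)
  finally have *: "(1 - q ^ (2 * ?m + 1)) * (1 + q ^ ?m) * ?B ?m = (1 - q ^ ?m) * ?B n"
    by simp
  \<comment> \<open>The additional \<open>1 - q ^ ?m\<close> completes the product that
    \<open>P_odd_step\<close> requires.\<close>
  have "(1 - q ^ (2 * ?m + 1)) * (1 - q ^ ?m) * (1 + q ^ ?m) * ?B ?m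
      = (1 - q ^ ?m) * ((1 - q ^ ?m) * ?B n)"
    unfolding *[symmetric] by (simp only: mult_ac)
  also have "\<dots> = (1 - q ^ (2 * ?m + 1)) * (1 - q ^ ?m) * (1 + q ^ ?m) * (P (2 * ?m + 1) * (\<Prod>i=1..?m. 1 - q ^ i)\<^sup>2)"
    unfolding Suc.IH P_odd_step[of n, symmetric] prod.cl_ivl_Suc power2_eq_square
    by (simp add: mult_ac)
  finally have "(1 - q ^ (2 * ?m + 1)) * (1 - q ^ ?m) * (1 + q ^ ?m) * ?B ?m
    = (1 - q ^ (2 * ?m + 1)) * (1 - q ^ ?m) * (1 + q ^ ?m) * (P (2 * ?m + 1) * (\<Prod>i=1..?m. 1 - q ^ i)\<^sup>2)" .
  moreover have nz3: "1 + q ^ ?m \<noteq> 0"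
  proof
    assume "1 + q ^ ?m = 0"
    then have "q ^ ?m = - 1"
      by (simp only: eq_neg_iff_add_eq_0 add.commute)
    then have "q ^ (?m * 2) = 1"
      by (simp only: power_mult) simp
    then show False
      using one_minus_power_neq_0[of "?m * 2"] by simp
  qed
  moreover have nz: "1 - q ^ (2 * ?m + 1) \<noteq> 0" "1 - q ^ ?m \<noteq> 0"
    by (rule one_minus_power_neq_0; simp)+
  ultimately show ?case
    using mult_left_cancel[OF no_zero_divisors[OF no_zero_divisors[OF nz] nz3]] by blast
qed

text \<open>Here \<open>g k\<close> stands for \<open>1 / (1 + q ^ k)\<close>. The left side does
  not depend on \<open>n\<close>: one step changes it by a multiple of the bracket in
  \<open>crank_telescope\<close>, which is 0.\<close>

lemma crank_finite:
  assumes g: "\<And>k. 0 < k \<Longrightarrow> g k * (1 + q ^ k) = 1"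
  shows "(\<Prod>i=1..n. 1 + q ^ i)\<^sup>2
    * (P n * P n + 4 * (\<Sum>k=1..n. (-1) ^ k * (q ^ triangle k * g k) * (P (n - k) * P (k + n)))) = 1"
proof (induction n)
  case 0
  show ?case by (simp add: P_0)
next
  case (Suc n)
  let ?m = "Suc n"
  let ?w = "\<lambda>k. (-1) ^ k * (q ^ triangle k * g k)"
  let ?u = "\<lambda>k. P (?m - k) * P (k + ?m)"
  let ?Z = "\<lambda>n. P n * P n + 4 * (\<Sum>k=1..n. ?w k * (P (n - k) * P (k + n)))"
  have pred: "(\<Sum>k=1..?m. ?w k * (?u k * ((1 - q ^ (?m - k)) * (1 - q ^ (k + ?m)))))
      = (\<Sum>k=1..n. ?w k * (P (n - k) * P (k + n)))"
  proof -
    have "?u k * ((1 - q ^ (?m - k)) * (1 - q ^ (k + ?m))) = P (n - k) * P (k + n)" if "k \<le> n" for k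
    proof -
      have "P (?m - k) * (1 - q ^ (?m - k)) = P (n - k)"
        using P_Suc[of "n - k"] that by (simp add: Suc_diff_le)
      moreover have "P (k + ?m) * (1 - q ^ (k + ?m)) = P (k + n)"
        using P_Suc[of "k + n"] by simp
      moreover have "?u k * ((1 - q ^ (?m - k)) * (1 - q ^ (k + ?m)))
          = (P (?m - k) * (1 - q ^ (?m - k))) * (P (k + ?m) * (1 - q ^ (k + ?m)))"
        by (simp only: mult_ac)
      ultimately show ?thesis
        by (simp only:)
    qed
    then have "(\<Sum>k=1..n. ?w k * (?u k * ((1 - q ^ (?m - k)) * (1 - q ^ (k + ?m)))))
        = (\<Sum>k=1..n. ?w k * (P (n - k) * P (k + n)))"
      by (intro sum.cong refl) (simp only: atLeastAtMost_iff)
    moreover have "(\<Sum>k=1..?m. h k * (?u k * ((1 - q ^ (?m - k)) * (1 - q ^ (k + ?m)))))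
        = (\<Sum>k=1..n. h k * (?u k * ((1 - q ^ (?m - k)) * (1 - q ^ (k + ?m)))))" for h
      by simp
    ultimately show ?thesis
      by (simp only:)
  qed
  \<comment> \<open>The difference of the two factors is
    \<open>q ^ (?m - k) * (1 + q ^ k)\<^sup>2\<close>, and one \<open>1 + q ^ k\<close> cancels
    against \<open>g k\<close>.\<close>
  have summand: "?w k * ?u k * (1 + q ^ ?m)\<^sup>2 - ?w k * (?u k * ((1 - q ^ (?m - k)) * (1 - q ^ (k + ?m))))
      = q ^ ?m * ((-1) ^ k * q ^ triangle (k - 1) * (1 + q ^ k) * ?u k)" if k: "k \<in> {1..?m}" for k
  proof -
    obtain i where i: "?m = k + i" using k le_Suc_ex[of k ?m] by auto
    obtain l where l: "k = Suc l" using k by (cases k) auto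
    have 1: "(1 + q ^ ?m)\<^sup>2 - (1 - q ^ (?m - k)) * (1 - q ^ (k + ?m)) = q ^ i * (1 + q ^ k)\<^sup>2"
      unfolding i by (simp add: power_add algebra_simps power2_eq_square)
    have 2: "q ^ triangle k * q ^ i = q ^ ?m * q ^ triangle (k - 1)"
      unfolding i by (simp add: l power_add mult_ac)
    have 3: "g k * (1 + q ^ k) = 1"
      by (rule g) (simp add: l)
    have "e * (t * c) * u * x - e * (t * c) * (u * y) = M * (e * t' * d * u)"
      if "x - y = j * d\<^sup>2" "t * j = M * t'" "c * d = 1" for e t c u x y M t' d j :: 'a
    proof -
      have "e * (t * c) * u * x - e * (t * c) * (u * y) = e * t * c * u * (x - y)"
        by (simp add: algebra_simps)
      also have "\<dots> = e * (t * j) * (c * d) * d * u"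
        unfolding that(1) by (simp add: power2_eq_square mult_ac)
      finally show ?thesis
        unfolding that(2,3) by (simp add: mult_ac)
    qed
    from this[OF 1 2 3] show ?thesis .
  qed
  have "P ?m * (1 - q ^ ?m) = P n"
    by (rule P_Suc)
  then have "P n * P n = P ?m * P ?m * (1 - q ^ ?m)\<^sup>2"
    unfolding power2_eq_square by (simp only: flip: \<open>P ?m * (1 - q ^ ?m) = P n\<close>) (simp only: mult_ac)
  \<comment> \<open>With \<open>x = q ^ ?m\<close>, the term outside the sum also acquires the
    factor \<open>4 * x\<close>; this is why the sum carries the coefficient 4.\<close>
  moreover have "(1 + x)\<^sup>2 * (p + 4 * S) - (p * (1 - x)\<^sup>2 + 4 * S') = 4 * x * p + 4 * (S * (1 + x)\<^sup>2 - S')"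
    for x p S S' :: 'a
    by (simp add: algebra_simps power2_eq_square)
  ultimately have "(1 + q ^ ?m)\<^sup>2 * ?Z ?m - ?Z n = 4 * q ^ ?m * (P ?m * P ?m) +
      4 * (\<Sum>k=1..?m. ?w k * ?u k * (1 + q ^ ?m)\<^sup>2 - ?w k * (?u k * ((1 - q ^ (?m - k)) * (1 - q ^ (k + ?m)))))"
    unfolding sum_subtractf pred sum_distrib_right[symmetric]
    by (simp only:)
  also have "\<dots> = 4 * q ^ ?m * (P ?m * P ?m
      + (\<Sum>k=1..?m. (-1) ^ k * q ^ triangle (k - 1) * (1 + q ^ k) * ?u k))"
  proof -
    have "(\<Sum>k=1..?m. ?w k * ?u k * (1 + q ^ ?m)\<^sup>2 - ?w k * (?u k * ((1 - q ^ (?m - k)) * (1 - q ^ (k + ?m)))))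
        = q ^ ?m * (\<Sum>k=1..?m. (-1) ^ k * q ^ triangle (k - 1) * (1 + q ^ k) * ?u k)"
      unfolding sum_distrib_left by (intro sum.cong refl summand)
    then show ?thesis
      by (simp only: distrib_left mult_ac)
  qed
  also have "\<dots> = 0"
  proof -
    have *: "(1 - q ^ ?m) * (P ?m * P ?m
      + (\<Sum>k=1..?m. (-1) ^ k * q ^ triangle (k - 1) * (1 + q ^ k) * ?u k)) = 0"
      by (subst crank_telescope) auto
    have "P ?m * P ?m
        + (\<Sum>k=1..?m. (-1) ^ k * q ^ triangle (k - 1) * (1 + q ^ k) * ?u k) = 0"
      by (rule eq_0_if_mult_eq_0[OF trans[OF mult.commute *]]) (rule one_minus_power_neq_0, simp)
    then show ?thesis
      by (simp only: mult_zero_right)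
  qed
  finally have "(1 + q ^ ?m)\<^sup>2 * ?Z ?m = ?Z n"
    by (simp only: right_minus_eq)
  moreover have "(\<Prod>i=1..?m. 1 + q ^ i)\<^sup>2 * ?Z ?m = (\<Prod>i=1..n. 1 + q ^ i)\<^sup>2 * ((1 + q ^ ?m)\<^sup>2 * ?Z ?m)"
    unfolding mult.assoc[symmetric] power_mult_distrib[symmetric] by simp
  ultimately show ?case
    using Suc.IH by (simp only:)
qed

end

section \<open>Generating functions of partitions\<close>

definition bounded_partitions :: "nat \<Rightarrow> nat \<Rightarrow> nat multiset set" where
  "bounded_partitions m N = {p \<in> integer_partitions N. set_mset p \<subseteq> {..m}}"

definition bounded_partition_fps :: "nat \<Rightarrow> int fps" where
  "bounded_partition_fps m = Abs_fps (\<lambda>N. int (card (bounded_partitions m N)))"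

definition partition_fps :: "int fps" where
  "partition_fps = Abs_fps (\<lambda>N. int (card (integer_partitions N)))"

lemma part_le: "p \<in> integer_partitions N \<Longrightarrow> k \<in># p \<Longrightarrow> k \<le> N"
  by (auto simp: integer_partitions_def dest!: multi_member_split)

lemma finite_bounded_partitions: "finite (bounded_partitions m N)"
  unfolding bounded_partitions_def by (simp add: finite_integer_partitions)

lemma bounded_partitions_Suc:
  "bounded_partitions (Suc m) N = bounded_partitions m N
    \<union> (if N < Suc m then {} else add_mset (Suc m) ` bounded_partitions (Suc m) (N - Suc m))"
proof (intro equalityI subsetI)
  fix p assume p: "p \<in> bounded_partitions (Suc m) N"
  show "p \<in> bounded_partitions m N
    \<union> (if N < Suc m then {} else add_mset (Suc m) ` bounded_partitions (Suc m) (N - Suc m))"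
  proof (cases "Suc m \<in># p")
    case True
    then obtain r where r: "p = add_mset (Suc m) r"
      by (metis insert_DiffM)
    with p have "r \<in> bounded_partitions (Suc m) (N - Suc m)" "Suc m \<le> N"
      by (auto simp: bounded_partitions_def integer_partitions_def)
    with r show ?thesis by auto
  next
    case False
    have "k \<le> m" if "k \<in># p" for k
    proof -
      have "k \<le> Suc m" using p that by (auto simp: bounded_partitions_def)
      moreover have "k \<noteq> Suc m" using False that by auto
      ultimately show ?thesis by simp
    qed
    with p show ?thesis
      by (auto simp: bounded_partitions_def)
  qed
qed (auto simp: bounded_partitions_def integer_partitions_def split: if_splits; force)

lemma card_bounded_partitions_Suc:
  "card (bounded_partitions (Suc m) N) = card (bounded_partitions m N)
    + (if N < Suc m then 0 else card (bounded_partitions (Suc m) (N - Suc m)))"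
proof (cases "N < Suc m")
  case False
  have "card (add_mset (Suc m) ` bounded_partitions (Suc m) (N - Suc m))
      = card (bounded_partitions (Suc m) (N - Suc m))"
    by (intro card_image) (auto simp: inj_on_def)
  moreover have "bounded_partitions m N \<inter> add_mset (Suc m) ` bounded_partitions (Suc m) (N - Suc m) = {}"
    by (auto simp: bounded_partitions_def)
  ultimately show ?thesis
    using False finite_bounded_partitions
    by (subst bounded_partitions_Suc) (simp add: card_Un_disjoint)
qed (simp add: bounded_partitions_Suc[of m N])

lemma bounded_partition_fps_0: "bounded_partition_fps 0 = 1"
proof -
  have "bounded_partitions 0 N = (if N = 0 then {{#}} else {})" for N
  proof -
    have "p = {#}" if "0 \<notin># p" "set_mset p \<subseteq> {..0}" for p :: "nat multiset"
      using that by (metis atMost_0 multiset_nonemptyE singletonD subsetD)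
    then have "p \<in> bounded_partitions 0 N \<longleftrightarrow> p = {#} \<and> N = 0" for p
      by (force simp: bounded_partitions_def integer_partitions_def)
    then show ?thesis
      by auto
  qed
  then show ?thesis
    by (auto simp: bounded_partition_fps_def fps_eq_iff)
qed

lemma bounded_partition_fps_Suc:
  "bounded_partition_fps (Suc m) * (1 - fps_X ^ Suc m) = bounded_partition_fps m"
  by (simp only: fps_eq_iff right_diff_distrib fps_sub_nth fps_X_power_mult_right_nth)
    (simp add: bounded_partition_fps_def card_bounded_partitions_Suc)

section \<open>Partitions with a given part of odd multiplicity\<close>

definition odd_count_fps :: "nat \<Rightarrow> int fps" where
  "odd_count_fps k = Abs_fps (\<lambda>N. int (card {p \<in> integer_partitions N. odd (count p k)}))"

text \<open>Removing one \<open>k\<close> flips the parity of its multiplicity, so the first set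
  matches the partitions of \<open>N\<close> with even multiplicity, the complement of the
  second.\<close>

lemma card_odd_count:
  assumes "0 < k"
  shows "card {p \<in> integer_partitions (N + k). odd (count p k)} + card {p \<in> integer_partitions N. odd (count p k)}
    = card (integer_partitions N)"
proof -
  have "{p \<in> integer_partitions (N + k). odd (count p k)}
      = add_mset k ` {p \<in> integer_partitions N. even (count p k)}"
  proof (intro equalityI subsetI)
    fix p assume p: "p \<in> {p \<in> integer_partitions (N + k). odd (count p k)}"
    then have "k \<in># p"
      by (auto intro: ccontr simp: count_eq_zero_iff[symmetric])
    then obtain r where r: "p = add_mset k r"
      by (metis insert_DiffM)
    with p show "p \<in> add_mset k ` {p \<in> integer_partitions N. even (count p k)}"
      by (auto simp: integer_partitions_def)
  qed (use assms in \<open>auto simp: integer_partitions_def\<close>)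
  then have "card {p \<in> integer_partitions (N + k). odd (count p k)} = card {p \<in> integer_partitions N. even (count p k)}"
    by (simp add: card_image inj_on_def)
  moreover have "card {p \<in> integer_partitions N. even (count p k)} + card {p \<in> integer_partitions N. odd (count p k)}
    = card ({p \<in> integer_partitions N. even (count p k)} \<union> {p \<in> integer_partitions N. odd (count p k)})"
    by (subst card_Un_disjoint) (auto simp: finite_integer_partitions)
  moreover have "{p \<in> integer_partitions N. even (count p k)} \<union> {p \<in> integer_partitions N. odd (count p k)} = integer_partitions N"
    by auto
  ultimately show ?thesis
    by simp
qed

lemma odd_count_fps_times:
  assumes "0 < k"
  shows "odd_count_fps k * (1 + fps_X ^ k) = partition_fps * fps_X ^ k"
proof (rule fps_ext)
  fix N
  show "(odd_count_fps k * (1 + fps_X ^ k)) $ N = (partition_fps * fps_X ^ k) $ N"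
  proof (cases "N < k")
    case True
    have "odd (count p k) \<Longrightarrow> p \<in> integer_partitions N \<Longrightarrow> False" for p
      using part_le[of p N k] True by (cases "k \<in># p") (auto simp: not_in_iff)
    then have "{p \<in> integer_partitions N. odd (count p k)} = {}"
      by blast
    then have "odd_count_fps k $ N = 0"
      unfolding odd_count_fps_def by (simp only: fps_nth_Abs_fps card.empty)
    then show ?thesis
      using True by (simp add: distrib_left fps_X_power_mult_right_nth)
  next
    case False
    then have "card {p \<in> integer_partitions N. odd (count p k)} + card {p \<in> integer_partitions (N - k). odd (count p k)}
      = card (integer_partitions (N - k))"
      using card_odd_count[OF assms, of "N - k"] by simp
    then show ?thesis
      using False by (simp add: distrib_left fps_X_power_mult_right_nth odd_count_fps_def partition_fps_def flip: of_nat_add)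
  qed
qed

text \<open>The geometric series of \<open>1 / (1 + q ^ k)\<close> for positive
  \<open>k\<close>.\<close>

definition alternating_fps :: "nat \<Rightarrow> int fps" where
  "alternating_fps k = Abs_fps (\<lambda>i. if k dvd i then (-1) ^ (i div k) else 0)"

lemma alternating_fps_inverse:
  assumes "0 < k"
  shows "alternating_fps k * (1 + fps_X ^ k) = 1"
proof (rule fps_ext)
  fix i
  show "(alternating_fps k * (1 + fps_X ^ k)) $ i = 1 $ i"
  proof (cases "k dvd i")
    case True
    then obtain j where "i = k * j" ..
    then show ?thesis
      using assms
      by (cases j) (auto simp: distrib_left fps_X_power_mult_right_nth alternating_fps_def)
  next
    case False
    moreover from this have "i \<noteq> 0"
      by (metis dvd_0_right)
    moreover have "\<not> k dvd i - k" if "k \<le> i"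
      using False that by (simp add: dvd_minus_self)
    ultimately show ?thesis
      by (simp add: distrib_left fps_X_power_mult_right_nth alternating_fps_def)
  qed
qed

lemma odd_count_fps_eq:
  assumes "0 < k"
  shows "odd_count_fps k = partition_fps * (fps_X ^ k * alternating_fps k)"
proof -
  have "odd_count_fps k = odd_count_fps k * (1 + fps_X ^ k) * alternating_fps k"
    using alternating_fps_inverse[OF assms] by (simp add: mult_ac)
  then show ?thesis
    by (simp add: odd_count_fps_times[OF assms] mult.assoc)
qed

text \<open>Writing the at most one term as a sum over solutions \<open>m\<close> turns the
  coefficients of both Lambert series into sums over pairs, which can be reindexed.\<close>

lemma alternating_fps_shift_nth:
  assumes "0 < k"
  shows "(fps_X ^ t * alternating_fps k) $ M = (\<Sum>m | m \<le> M \<and> t + k * m = M. (-1) ^ m)"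
proof (cases "t \<le> M \<and> k dvd M - t")
  case True
  then obtain j where j: "M - t = k * j" by blast
  then have "{m. m \<le> M \<and> t + k * m = M} = {j}"
  proof -
    have M: "M = t + k * j" using True j by simp
    have "j \<le> M" using assms by (simp add: M trans_le_add2)
    then show ?thesis using assms by (auto simp: M)
  qed
  then show ?thesis
    using True j assms by (simp add: fps_X_power_mult_nth alternating_fps_def)
next
  case False
  then have "{m. m \<le> M \<and> t + k * m = M} = {}"
    by auto
  then show ?thesis
    using False by (simp only:) (auto simp: fps_X_power_mult_nth alternating_fps_def)
qed

section \<open>Rearrangement of the Lambert series\<close>

definition chi4 :: "nat \<Rightarrow> int" where
  "chi4 k = (if k mod 4 = 1 then 1 else if k mod 4 = 3 then -1 else 0)"

lemma chi4_even [simp]: "chi4 (2 * a) = 0"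
  unfolding chi4_def by presburger

lemma chi4_odd: "chi4 (2 * a + 1) = (-1) ^ a"
proof (cases "even a")
  case True
  then obtain b where "a = 2 * b" ..
  then show ?thesis by (simp add: chi4_def)
next
  case False
  then obtain b where "a = 2 * b + 1" by (rule oddE)
  then show ?thesis by (simp add: chi4_def)
qed

lemma triangle_odd: "triangle (2 * a + 1) = (2 * a + 1) * (a + 1)"
  and triangle_even: "triangle (2 * a) = a * (2 * a + 1)"
  unfolding triangle_def by (simp_all add: algebra_simps)

text \<open>
The left side sums over \<open>2 M = k (k + 1 + 2 m)\<close>, that is, over the factorizations of \<open>2 M\<close> into factors of
opposite parity with \<open>k\<close> the smaller one. The right side sums over the odd factor \<open>d\<close>, the even one
being \<open>2 (e + 1)\<close>.
\<close>

lemma lambert_rearrangement: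
  assumes "M \<le> N"
  shows "(\<Sum>k=1..N. (-1) ^ (k - 1) * (fps_X ^ triangle k * alternating_fps k) $ M)
    = (\<Sum>k=1..N. chi4 k * (fps_X ^ k * alternating_fps k) $ M)"
proof -
  let ?A = "SIGMA k:{1..N}. {m. m \<le> M \<and> triangle k + k * m = M}"
  let ?B = "SIGMA k:{1..N}. {m. m \<le> M \<and> k + k * m = M}"
  have "(\<Sum>k=1..N. (-1) ^ (k - 1) * (fps_X ^ triangle k * alternating_fps k) $ M)
      = (\<Sum>(k, m)\<in>?A. (-1) ^ (k - 1) * (-1) ^ m)"
    by (subst sum.Sigma[symmetric]) (auto simp: alternating_fps_shift_nth sum_distrib_left)
  also have "\<dots> = (\<Sum>(k, m)\<in>{x \<in> ?B. odd (fst x)}. chi4 k * (-1) ^ m)"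
  \<comment> \<open>Both maps preserve the unordered pair of factors \<open>k\<close>,
    \<open>k + 1 + 2 * m\<close>, respectively \<open>d\<close>, \<open>2 * (e + 1)\<close>:
    \<open>j\<close> picks the odd factor and \<open>i\<close> the smaller one.\<close>
  proof (rule sum.reindex_bij_witness[where
        i = "\<lambda>(d, e). if d < 2 * (e + 1) then (d, e - (d - 1) div 2) else (2 * (e + 1), (d - 1) div 2 - (e + 1))"
        and j = "\<lambda>(k, m). if odd k then (k, (k - 1) div 2 + m) else (k + 1 + 2 * m, k div 2 - 1)"])
    fix x assume x: "x \<in> ?A"
    obtain k m where km: "x = (k, m)" by (cases x)
    show "(case case x of (k, m) \<Rightarrow> if odd k then (k, (k - 1) div 2 + m) else (k + 1 + 2 * m, k div 2 - 1) of
        (d, e) \<Rightarrow> if d < 2 * (e + 1) then (d, e - (d - 1) div 2) else (2 * (e + 1), (d - 1) div 2 - (e + 1))) = x"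
      using x unfolding km by (auto elim!: oddE evenE)
    show "(case x of (k, m) \<Rightarrow> if odd k then (k, (k - 1) div 2 + m) else (k + 1 + 2 * m, k div 2 - 1)) \<in> {x \<in> ?B. odd (fst x)}"
    proof (cases "odd k")
      case True
      then obtain a where a: "k = 2 * a + 1" by (rule oddE)
      have "M = triangle k + k * m"
        using x km by simp
      then have "M = k + k * (a + m)"
        unfolding a triangle_odd by (simp add: algebra_simps)
      then show ?thesis
        using x True unfolding km by (auto simp: a)
    next
      case False
      then obtain a where a: "k = 2 * a" by auto
      with x km have "0 < a" by auto
      then obtain b where b: "a = b + 1" by (metis Suc_eq_plus1 gr0_implies_Suc)
      have "M = triangle k + k * m"
        using x km by simp
      then have M: "M = (k + 1 + 2 * m) + (k + 1 + 2 * m) * b"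
        unfolding a triangle_even by (simp add: b algebra_simps)
      \<comment> \<open>The new first index stays in \<open>{1..N}\<close> because it is at most
        \<open>M\<close> and \<open>M \<le> N\<close>.\<close>
      then have "k + 1 + 2 * m \<le> M" "b \<le> M"
        by simp_all
      then show ?thesis
        using x False assms M unfolding km by (auto simp: a b)
    qed
    show "(case case x of (k, m) \<Rightarrow> if odd k then (k, (k - 1) div 2 + m) else (k + 1 + 2 * m, k div 2 - 1) of
         (k, m) \<Rightarrow> chi4 k * (- 1) ^ m) = (case x of (k, m) \<Rightarrow> (- 1) ^ (k - 1) * (- 1) ^ m)"
    proof (cases "odd k")
      case True
      then obtain a where a: "k = 2 * a + 1" by (rule oddE)
      then show ?thesis
        using True chi4_odd[of a] by (simp add: km power_add flip: power_mult_distrib)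
    next
      case False
      then obtain a where a: "k = 2 * a" by auto
      with x km have "0 < a" by auto
      then obtain b where b: "a = b + 1" by (metis Suc_eq_plus1 gr0_implies_Suc)
      show ?thesis
        using False chi4_odd[of "a + m"] by (simp add: km a b power_add)
    qed
  next
    fix x assume x: "x \<in> {x \<in> ?B. odd (fst x)}"
    obtain d e where de: "x = (d, e)" by (cases x)
    obtain a where a: "d = 2 * a + 1" using x de by (auto elim: oddE)
    have M: "M = (2 * a + 1) * (e + 1)" using x de a by auto
    show "(case case x of (d, e) \<Rightarrow> if d < 2 * (e + 1) then (d, e - (d - 1) div 2) else (2 * (e + 1), (d - 1) div 2 - (e + 1)) of
        (k, m) \<Rightarrow> if odd k then (k, (k - 1) div 2 + m) else (k + 1 + 2 * m, k div 2 - 1)) = x"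
      by (auto simp: de a)
    show "(case x of (d, e) \<Rightarrow> if d < 2 * (e + 1) then (d, e - (d - 1) div 2) else (2 * (e + 1), (d - 1) div 2 - (e + 1))) \<in> ?A"
    proof (cases "d < 2 * (e + 1)")
      case True
      then obtain m where m: "e = a + m" using a le_Suc_ex[of a e] by auto
      have "M = triangle d + d * m"
        unfolding a triangle_odd M m by (simp add: algebra_simps)
      moreover have "m \<le> M" unfolding M m by simp
      ultimately show ?thesis
        using x True by (auto simp: de a m)
    next
      case False
      then obtain m where m: "a = e + 1 + m" using a le_Suc_ex[of "e + 1" a] by auto
      have "M = triangle (2 * (e + 1)) + (2 * (e + 1)) * m"
        unfolding triangle_even M m by (simp add: algebra_simps)
      moreover have "m \<le> M" "2 * (e + 1) \<le> M" unfolding M m by simp_all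
      ultimately show ?thesis
        using x False assms by (auto simp: de a m)
    qed
  qed
  also have "\<dots> = (\<Sum>(k, m)\<in>?B. chi4 k * (-1) ^ m)"
    by (rule sum.mono_neutral_left) (auto elim!: evenE)
  also have "\<dots> = (\<Sum>k=1..N. chi4 k * (fps_X ^ k * alternating_fps k) $ M)"
    by (subst sum.Sigma[symmetric]) (auto simp: alternating_fps_shift_nth sum_distrib_left)
  finally show ?thesis .
qed


section \<open>Truncated theta identities\<close>

interpretation partitions: q_reciprocals "fps_X :: int fps" bounded_partition_fps
proof
  show "(fps_X :: int fps) ^ Suc m \<noteq> 1" for m
    by (metis fps_X_power_nth fps_one_nth nat.distinct(1) one_neq_zero)
qed (rule bounded_partition_fps_0 bounded_partition_fps_Suc)+

text \<open>Congruence modulo q^(N+1). It replaces limits: infinite sums and products appear only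
  through truncations that are exact up to degree \<open>N\<close>.\<close>

definition fps_eq_upto :: "nat \<Rightarrow> 'a::comm_ring_1 fps \<Rightarrow> 'a fps \<Rightarrow> bool" where
  "fps_eq_upto N f g \<longleftrightarrow> (\<forall>i\<le>N. f $ i = g $ i)"

lemma fps_numeral_mult_nth: "(numeral k * f) $ i = numeral k * f $ i"
  for f :: "'a::comm_ring_1 fps"
  by (metis fps_mult_left_const_nth numeral_fps_const)

lemma fps_eq_upto_refl [simp]: "fps_eq_upto N f f"
  by (simp add: fps_eq_upto_def)

lemma fps_eq_upto_sym: "fps_eq_upto N f g \<Longrightarrow> fps_eq_upto N g f"
  by (simp add: fps_eq_upto_def)

lemma fps_eq_upto_trans [trans]: "fps_eq_upto N f g \<Longrightarrow> fps_eq_upto N g h \<Longrightarrow> fps_eq_upto N f h"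
  by (simp add: fps_eq_upto_def)

lemma fps_eq_upto_add: "fps_eq_upto N f g \<Longrightarrow> fps_eq_upto N f' g' \<Longrightarrow> fps_eq_upto N (f + f') (g + g')"
  by (simp add: fps_eq_upto_def)

lemma fps_eq_upto_mult: "fps_eq_upto N f g \<Longrightarrow> fps_eq_upto N f' g' \<Longrightarrow> fps_eq_upto N (f * f') (g * g')"
  by (simp add: fps_eq_upto_def fps_mult_nth)

lemma fps_eq_upto_power: "fps_eq_upto N f g \<Longrightarrow> fps_eq_upto N (f ^ k) (g ^ k)"
  by (induction k) (simp_all add: fps_eq_upto_mult)

lemma fps_eq_upto_sum:
  "(\<And>k. k \<in> A \<Longrightarrow> fps_eq_upto N (f k) (g k)) \<Longrightarrow> fps_eq_upto N (sum f A) (sum g A)"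
  by (simp add: fps_eq_upto_def fps_sum_nth)

lemma fps_eq_upto_compose: "fps_eq_upto N f g \<Longrightarrow> fps_eq_upto N (f oo h) (g oo h)"
  by (simp add: fps_eq_upto_def fps_compose_nth)

lemma fps_eq_upto_X_power_mult:
  assumes "fps_eq_upto M f g" and "N \<le> M + t"
  shows "fps_eq_upto N (fps_X ^ t * f) (fps_X ^ t * g)"
  using assms by (auto simp: fps_eq_upto_def fps_X_power_mult_nth)

lemma bounded_partition_fps_upto: "N \<le> m \<Longrightarrow> fps_eq_upto N (bounded_partition_fps m) partition_fps"
proof -
  assume "N \<le> m"
  then have "bounded_partitions m i = integer_partitions i" if "i \<le> N" for i
    using that part_le by (fastforce simp: bounded_partitions_def)
  then show ?thesis
    by (simp add: fps_eq_upto_def bounded_partition_fps_def partition_fps_def)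
qed

lemma le_triangle: "k \<le> triangle k"
  by (induction k) auto

text \<open>\<open>bounded_partition_fps (N - k)\<close> is known to be exact only up to degree
  \<open>N - k\<close>; the factor \<open>fps_X ^ triangle k\<close> supplies the missing
  \<open>k\<close> degrees.\<close>

lemma triangle_bounded_partition_fps:
  assumes "k \<le> N" and "N \<le> m"
  shows "fps_eq_upto N (fps_X ^ triangle k * (bounded_partition_fps (N - k) * bounded_partition_fps m))
    (fps_X ^ triangle k * (partition_fps * partition_fps))"
  unfolding mult.assoc[symmetric]
proof (rule fps_eq_upto_mult)
  show "fps_eq_upto N (fps_X ^ triangle k * bounded_partition_fps (N - k)) (fps_X ^ triangle k * partition_fps)"
    by (rule fps_eq_upto_X_power_mult[OF bounded_partition_fps_upto[OF order_refl]])
      (use assms le_triangle[of k] in linarith)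
qed (rule bounded_partition_fps_upto[OF assms(2)])

section \<open>Truncated theta series and their products\<close>

definition psi_sum :: "nat \<Rightarrow> int fps" where
  "psi_sum N = (\<Sum>k\<le>N. fps_X ^ triangle k)"

definition jacobi_sum :: "nat \<Rightarrow> int fps" where
  "jacobi_sum N = (\<Sum>k\<le>N. (-1) ^ k * of_nat (2 * k + 1) * fps_X ^ triangle k)"

text \<open>Truncation of E^2 / R^2. Divided by E it gives E / R^2, the crank generating function at
  z = -1.\<close>

definition crank_sum :: "nat \<Rightarrow> int fps" where
  "crank_sum N = 1 + 4 * (\<Sum>k=1..N. (-1) ^ k * (fps_X ^ triangle k * alternating_fps k))"

definition qprod_minus :: "nat \<Rightarrow> int fps" where
  "qprod_minus N = (\<Prod>i=1..N. 1 - fps_X ^ i)"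

definition qprod_plus :: "nat \<Rightarrow> int fps" where
  "qprod_plus N = (\<Prod>i=1..N. 1 + fps_X ^ i)"

lemma bounded_partition_fps_qprod: "bounded_partition_fps N * qprod_minus N = 1"
proof (induction N)
  case (Suc N)
  have "bounded_partition_fps (Suc N) * qprod_minus (Suc N)
      = bounded_partition_fps (Suc N) * (1 - fps_X ^ Suc N) * qprod_minus N"
    unfolding qprod_minus_def prod.cl_ivl_Suc by (simp add: mult_ac)
  then show ?case
    by (simp only: bounded_partition_fps_Suc Suc.IH)
qed (simp add: bounded_partition_fps_0 qprod_minus_def)

lemma partition_fps_qprod: "fps_eq_upto N (partition_fps * qprod_minus N) 1"
  using fps_eq_upto_mult[OF fps_eq_upto_sym[OF bounded_partition_fps_upto[OF order_refl]] fps_eq_upto_refl]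
  by (metis bounded_partition_fps_qprod)

text \<open>Multiplied by the square of \<open>partition_fps\<close>, the sum agrees with the one in
  \<open>psi_finite\<close>; the square of \<open>qprod_minus N\<close> then cancels the partition
  series. The next two lemmas follow the same scheme.\<close>

lemma psi_sum_upto: "fps_eq_upto N (psi_sum N) (qprod_minus N * (qprod_plus N)\<^sup>2)"
proof -
  let ?P = partition_fps and ?Q = "qprod_minus N" and ?R = "qprod_plus N"
  have "fps_eq_upto N (psi_sum N * (?P * ?P))
      (\<Sum>k\<le>N. fps_X ^ triangle k * (bounded_partition_fps (N - k) * bounded_partition_fps (Suc (k + N))))"
    unfolding psi_sum_def sum_distrib_right
    by (intro fps_eq_upto_sum fps_eq_upto_sym[OF triangle_bounded_partition_fps]) auto
  also have "fps_eq_upto N \<dots> (?P * ?R\<^sup>2)"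
    unfolding partitions.psi_finite qprod_plus_def
    by (intro fps_eq_upto_mult bounded_partition_fps_upto) auto
  finally have "fps_eq_upto N ((psi_sum N * (?P * ?P)) * ?Q\<^sup>2) ((?P * ?R\<^sup>2) * ?Q\<^sup>2)"
    by (rule fps_eq_upto_mult) simp
  then have *: "fps_eq_upto N (psi_sum N * (?P * ?Q)\<^sup>2) (?P * ?Q * (?Q * ?R\<^sup>2))"
    by (simp add: power2_eq_square mult_ac)
  have "fps_eq_upto N (psi_sum N * 1\<^sup>2) (psi_sum N * (?P * ?Q)\<^sup>2)"
    by (intro fps_eq_upto_mult fps_eq_upto_power fps_eq_upto_refl fps_eq_upto_sym[OF partition_fps_qprod])
  also note *
  also have "fps_eq_upto N (?P * ?Q * (?Q * ?R\<^sup>2)) (1 * (?Q * ?R\<^sup>2))"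
    by (intro fps_eq_upto_mult fps_eq_upto_refl partition_fps_qprod)
  finally show ?thesis
    by simp
qed

lemma jacobi_sum_upto: "fps_eq_upto N (jacobi_sum N) (qprod_minus N ^ 3)"
proof -
  let ?P = partition_fps and ?Q = "qprod_minus N"
  have "fps_eq_upto N (jacobi_sum N * (?P * ?P))
      (\<Sum>k\<le>N. (-1) ^ k * of_nat (2 * k + 1) * (fps_X ^ triangle k
        * (bounded_partition_fps (N - k) * bounded_partition_fps (Suc (k + N)))))"
    unfolding jacobi_sum_def sum_distrib_right mult.assoc[of _ "fps_X ^ _"]
    by (intro fps_eq_upto_sum fps_eq_upto_mult fps_eq_upto_refl
        fps_eq_upto_sym[OF triangle_bounded_partition_fps]) auto
  also have "fps_eq_upto N \<dots> (?P * ?Q\<^sup>2)"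
    unfolding mult.assoc[of _ "fps_X ^ _", symmetric] partitions.jacobi_finite qprod_minus_def
    by (intro fps_eq_upto_mult bounded_partition_fps_upto) auto
  finally have "fps_eq_upto N ((jacobi_sum N * (?P * ?P)) * ?Q\<^sup>2) ((?P * ?Q\<^sup>2) * ?Q\<^sup>2)"
    by (rule fps_eq_upto_mult) simp
  then have *: "fps_eq_upto N (jacobi_sum N * (?P * ?Q)\<^sup>2) (?P * ?Q * ?Q ^ 3)"
    by (simp add: power2_eq_square power3_eq_cube mult_ac)
  have "fps_eq_upto N (jacobi_sum N * 1\<^sup>2) (jacobi_sum N * (?P * ?Q)\<^sup>2)"
    by (intro fps_eq_upto_mult fps_eq_upto_power fps_eq_upto_refl fps_eq_upto_sym[OF partition_fps_qprod])
  also note *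
  also have "fps_eq_upto N (?P * ?Q * ?Q ^ 3) (1 * ?Q ^ 3)"
    by (intro fps_eq_upto_mult fps_eq_upto_refl partition_fps_qprod)
  finally show ?thesis
    by simp
qed

lemma crank_sum_upto: "fps_eq_upto N (crank_sum N * (qprod_plus N)\<^sup>2) ((qprod_minus N)\<^sup>2)"
proof -
  let ?P = partition_fps and ?Q = "qprod_minus N" and ?R = "qprod_plus N"
  have "fps_eq_upto N (crank_sum N * (?P * ?P)) (bounded_partition_fps N * bounded_partition_fps N
     + 4 * (\<Sum>k=1..N. (-1) ^ k * (fps_X ^ triangle k * alternating_fps k)
         * (bounded_partition_fps (N - k) * bounded_partition_fps (k + N))))"
  proof -
    have "crank_sum N * (?P * ?P) = ?P * ?P
        + 4 * (\<Sum>k=1..N. (-1) ^ k * alternating_fps k * (fps_X ^ triangle k * (?P * ?P)))"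
      unfolding crank_sum_def distrib_right mult_1 mult.assoc[of 4] sum_distrib_right by (simp only: mult_ac)
    moreover have "fps_eq_upto N (?P * ?P
        + 4 * (\<Sum>k=1..N. (-1) ^ k * alternating_fps k * (fps_X ^ triangle k * (?P * ?P))))
      (bounded_partition_fps N * bounded_partition_fps N
        + 4 * (\<Sum>k=1..N. (-1) ^ k * alternating_fps k * (fps_X ^ triangle k
         * (bounded_partition_fps (N - k) * bounded_partition_fps (k + N)))))"
      by (intro fps_eq_upto_add fps_eq_upto_mult fps_eq_upto_sum fps_eq_upto_refl
        fps_eq_upto_sym[OF triangle_bounded_partition_fps] fps_eq_upto_sym[OF bounded_partition_fps_upto]) auto
    ultimately show ?thesis
      by (simp add: mult_ac)
  qed
  from fps_eq_upto_mult[OF fps_eq_upto_refl this, of "?R\<^sup>2"]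
  have "fps_eq_upto N (?R\<^sup>2 * (crank_sum N * (?P * ?P))) 1"
    by (simp only: qprod_plus_def partitions.crank_finite[OF alternating_fps_inverse, of N])
  then have "fps_eq_upto N (?R\<^sup>2 * (crank_sum N * (?P * ?P)) * ?Q\<^sup>2) (1 * ?Q\<^sup>2)"
    by (rule fps_eq_upto_mult) simp
  then have *: "fps_eq_upto N (crank_sum N * ?R\<^sup>2 * (?P * ?Q)\<^sup>2) (?Q\<^sup>2)"
    by (simp add: power2_eq_square mult_ac)
  have "fps_eq_upto N (crank_sum N * ?R\<^sup>2 * 1\<^sup>2) (crank_sum N * ?R\<^sup>2 * (?P * ?Q)\<^sup>2)"
    by (intro fps_eq_upto_mult fps_eq_upto_power fps_eq_upto_refl fps_eq_upto_sym[OF partition_fps_qprod])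
  also note *
  finally show ?thesis
    by simp
qed

section \<open>Divisibility by 5 in the progression \<open>5 n + 4\<close>\<close>

definition five_dvd_upto :: "nat \<Rightarrow> int fps \<Rightarrow> bool" where
  "five_dvd_upto N f \<longleftrightarrow> (\<forall>i\<le>N. i mod 5 = 4 \<longrightarrow> 5 dvd f $ i)"

lemma five_dvd_upto_cong: "fps_eq_upto N f g \<Longrightarrow> five_dvd_upto N f \<longleftrightarrow> five_dvd_upto N g"
  by (auto simp: fps_eq_upto_def five_dvd_upto_def)

lemma five_dvd_upto_sum: "(\<And>k. k \<in> A \<Longrightarrow> five_dvd_upto N (f k)) \<Longrightarrow> five_dvd_upto N (sum f A)"
  by (auto simp: five_dvd_upto_def fps_sum_nth intro!: dvd_sum)

lemma five_dvd_upto_add_5: "five_dvd_upto N (f + 5 * g) \<longleftrightarrow> five_dvd_upto N f"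
  by (simp add: five_dvd_upto_def fps_numeral_mult_nth dvd_add_left_iff)

text \<open>The factor relates \<open>f $ n\<close> only to \<open>f $ (n - 5 * i)\<close>, whose
  index lies in the same class modulo 5, so induction on \<open>n\<close> applies.\<close>

lemma five_dvd_upto_cancel_X_power_5:
  assumes "0 < i" and good: "five_dvd_upto N (f * (1 - fps_X ^ (5 * i)))"
  shows "five_dvd_upto N f"
  unfolding five_dvd_upto_def
proof (intro allI impI)
  fix n assume "n \<le> N" "n mod 5 = 4"
  then show "5 dvd f $ n"
  proof (induction n rule: less_induct)
    case (less n)
    have *: "5 dvd (f * (1 - fps_X ^ (5 * i))) $ n"
      using good less.prems by (simp add: five_dvd_upto_def)
    show ?case
    proof (cases "n < 5 * i")
      case True
      with * show ?thesis
        by (simp add: right_diff_distrib fps_X_power_mult_right_nth)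
    next
      case False
      then obtain j where n: "n = 5 * i + j"
        using le_Suc_ex[of "5 * i" n] by auto
      have "5 dvd f $ j"
        using less.prems assms(1) by (intro less.IH) (simp_all add: n)
      moreover have "5 dvd f $ n - f $ j"
        using * by (simp add: n right_diff_distrib fps_X_power_mult_right_nth)
      ultimately show ?thesis
        by (metis diff_add_cancel dvd_add)
    qed
  qed
qed

text \<open>Modulo 5 the fifth power of \<open>1 - x\<close> is \<open>1 - x ^ 5\<close>; the proof
  writes out the multiple of 5 by which they differ.\<close>

lemma five_dvd_upto_cancel_factor:
  assumes "0 < i" and "five_dvd_upto N (f * (1 - fps_X ^ i) ^ 5)"
  shows "five_dvd_upto N f"
proof -
  have "(1 - x) ^ 5 = (1 - x ^ 5) + 5 * (2 * x\<^sup>2 - x - 2 * x ^ 3 + x ^ 4)" for x :: "int fps"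
    by (simp add: algebra_simps eval_nat_numeral)
  then have "f * (1 - fps_X ^ i) ^ 5 = f * (1 - fps_X ^ (5 * i))
      + 5 * (f * (2 * (fps_X ^ i)\<^sup>2 - fps_X ^ i - 2 * (fps_X ^ i) ^ 3 + (fps_X ^ i) ^ 4))"
    by (simp add: distrib_left mult_ac flip: power_mult)
  with assms show ?thesis
    by (metis five_dvd_upto_add_5 five_dvd_upto_cancel_X_power_5)
qed

lemma five_dvd_upto_cancel_qprod:
  assumes "five_dvd_upto N (f * (\<Prod>i=1..m. 1 - fps_X ^ (2 * i)) ^ 5)"
  shows "five_dvd_upto N f"
  using assms
proof (induction m)
  case (Suc m)
  have "five_dvd_upto N (f * (\<Prod>i=1..m. 1 - fps_X ^ (2 * i)) ^ 5 * (1 - fps_X ^ (2 * Suc m)) ^ 5)"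
    using Suc.prems unfolding prod.cl_ivl_Suc by (simp add: power_mult_distrib mult.assoc)
  then have "five_dvd_upto N (f * (\<Prod>i=1..m. 1 - fps_X ^ (2 * i)) ^ 5)"
    by (rule five_dvd_upto_cancel_factor[rotated]) simp
  then show ?case
    by (rule Suc.IH)
qed simp

section \<open>Jacobi's series at the square of the variable\<close>

lemma qprod_minus_plus: "qprod_minus N * qprod_plus N = (\<Prod>i=1..N. 1 - fps_X ^ (2 * i))"
proof -
  have "(1 - x) * (1 + x) = 1 - x\<^sup>2" for x :: "int fps"
    by (simp add: algebra_simps power2_eq_square)
  then show ?thesis
    unfolding qprod_minus_def qprod_plus_def prod.distrib[symmetric]
    by (intro prod.cong refl) (simp add: mult.commute flip: power_mult)
qed

lemma qprod_minus_compose: "qprod_minus N oo fps_X\<^sup>2 = qprod_minus N * qprod_plus N"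
  unfolding qprod_minus_plus unfolding qprod_minus_def
  by (subst fps_compose_prod_distrib)
    (auto simp: fps_compose_sub_distrib fps_X_power_compose simp flip: power_mult)

text \<open>Constant series as coefficients make each term a monomial, the form that
  \<open>five_dvd_upto_monomial\<close> handles.\<close>

lemma jacobi_sum_eq:
  "jacobi_sum N = (\<Sum>k\<le>N. fps_const ((-1) ^ k * int (2 * k + 1)) * fps_X ^ triangle k)"
proof -
  have "fps_const ((-1) ^ k * int (2 * k + 1)) = (-1) ^ k * of_nat (2 * k + 1)" for k
  proof -
    have "fps_const ((-1) ^ k * int (2 * k + 1)) = fps_const (-1) ^ k * fps_const (of_nat (2 * k + 1))"
      by (simp only: fps_const_power fps_const_mult)
    also have "\<dots> = (-1) ^ k * of_nat (2 * k + 1)"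
      by (simp only: fps_of_nat fps_const_neg[symmetric] fps_const_1_eq_1)
    finally show ?thesis .
  qed
  then show ?thesis
    by (simp only: jacobi_sum_def)
qed

lemma jacobi_sum_compose:
  "jacobi_sum N oo fps_X\<^sup>2 = (\<Sum>k\<le>N. fps_const ((-1) ^ k * int (2 * k + 1)) * fps_X ^ (2 * triangle k))"
proof -
  have "(fps_const c * fps_X ^ m) oo fps_X\<^sup>2 = fps_const c * fps_X ^ (2 * m)" for c :: int and m
    by (simp add: fps_compose_mult_distrib fps_X_power_compose flip: power_mult)
  then show ?thesis
    by (simp only: jacobi_sum_eq fps_compose_sum_distrib)
qed

lemma jacobi_sum_compose_upto:
  "fps_eq_upto N ((qprod_minus N * qprod_plus N) ^ 3) (jacobi_sum N oo fps_X\<^sup>2)"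
proof -
  have "(qprod_minus N * qprod_plus N) ^ 3 = qprod_minus N ^ 3 oo fps_X\<^sup>2"
    unfolding qprod_minus_compose[symmetric] by (rule fps_compose_power) simp
  then show ?thesis
    using fps_eq_upto_compose[OF fps_eq_upto_sym[OF jacobi_sum_upto]] by metis
qed

lemma dvd_weight:
  assumes "(triangle j + 2 * triangle k) mod 5 = 4"
  shows "5 dvd 2 * k + 1"
proof -
  have t: "2 * triangle j = j * (j + 1)" for j
    by (induction j) auto
  \<comment> \<open>Doubling removes the halves in the triangular numbers, and the residue 4 becomes
    3.\<close>
  have "(2 * x) mod 5 = 3" if "x mod 5 = 4" for x :: nat
    using that by presburger
  from this[OF assms] have "(2 * triangle j + 2 * (2 * triangle k)) mod 5 = 3"
    by (simp only: distrib_left)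
  then have "(j * (j + 1) + 2 * (k * (k + 1))) mod 5 = 3"
    by (simp only: t)
  moreover have "((j mod 5) * (j mod 5 + 1) + 2 * ((k mod 5) * (k mod 5 + 1))) mod 5
      = (j * (j + 1) + 2 * (k * (k + 1))) mod 5"
    by (intro mod_add_cong mod_mult_cong) simp_all
  moreover have residues: "i mod 5 = 0 \<or> i mod 5 = 1 \<or> i mod 5 = 2 \<or> i mod 5 = 3 \<or> i mod 5 = 4" for i :: nat
    by presburger
  \<comment> \<open>Among the 25 pairs of residues of \<open>j\<close> and \<open>k\<close>, only
    (2, 2) satisfies the congruence.\<close>
  ultimately have "k mod 5 = 2"
    using residues[of j] residues[of k] by (elim disjE) simp_all
  then show ?thesis
    by presburger
qed

lemma dvd_coeff:
  assumes "(triangle j + 2 * triangle k) mod 5 = 4"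
  shows "(5 :: int) dvd (-1) ^ k * int (2 * k + 1)"
proof -
  have "int 5 dvd int (2 * k + 1)"
    using dvd_weight[OF assms] by (simp only: int_dvd_int_iff)
  then show ?thesis
    by (intro dvd_mult) simp
qed

lemma five_dvd_upto_monomial:
  assumes "m mod 5 = 4 \<Longrightarrow> 5 dvd c"
  shows "five_dvd_upto N (fps_const c * fps_X ^ m)"
  using assms by (auto simp: five_dvd_upto_def)

lemma five_dvd_upto_psi_jacobi: "five_dvd_upto N (psi_sum N * (jacobi_sum N oo fps_X\<^sup>2))"
proof -
  have "five_dvd_upto N (fps_X ^ triangle j * (fps_const ((-1) ^ k * int (2 * k + 1)) * fps_X ^ (2 * triangle k)))" for j k
  proof -
    have "fps_X ^ triangle j * (fps_const ((-1) ^ k * int (2 * k + 1)) * fps_X ^ (2 * triangle k))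
        = fps_const ((-1) ^ k * int (2 * k + 1)) * fps_X ^ (triangle j + 2 * triangle k)"
      by (simp only: power_add mult_ac)
    then show ?thesis
      using five_dvd_upto_monomial[OF dvd_coeff] by (simp only:)
  qed
  then show ?thesis
    unfolding jacobi_sum_compose psi_sum_def sum_product by (intro five_dvd_upto_sum)
qed

lemma five_dvd_upto_jacobi_jacobi: "five_dvd_upto N (jacobi_sum N * (jacobi_sum N oo fps_X\<^sup>2))"
proof -
  have "five_dvd_upto N (fps_const ((-1) ^ j * int (2 * j + 1)) * fps_X ^ triangle j
      * (fps_const ((-1) ^ k * int (2 * k + 1)) * fps_X ^ (2 * triangle k)))" for j k
  proof -
    have "fps_const ((-1) ^ j * int (2 * j + 1)) * fps_X ^ triangle j
        * (fps_const ((-1) ^ k * int (2 * k + 1)) * fps_X ^ (2 * triangle k))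
      = fps_const ((-1) ^ j * int (2 * j + 1) * ((-1) ^ k * int (2 * k + 1))) * fps_X ^ (triangle j + 2 * triangle k)"
      unfolding fps_const_mult[symmetric] power_add by (simp only: mult_ac)
    then show ?thesis
      using five_dvd_upto_monomial[OF dvd_mult[OF dvd_coeff]] by (simp only:)
  qed
  then show ?thesis
    unfolding jacobi_sum_compose unfolding jacobi_sum_eq sum_product by (intro five_dvd_upto_sum)
qed

text \<open>Ramanujan's congruence p(5n+4) = 0 modulo 5, up to degree \<open>N\<close>: one of the
  two terms of 4 F.\<close>

lemma five_dvd_upto_partition_fps: "five_dvd_upto N partition_fps"
proof (rule five_dvd_upto_cancel_qprod[of N _ N], fold qprod_minus_plus)
  let ?P = partition_fps and ?Q = "qprod_minus N" and ?R = "qprod_plus N"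
  have "?P * (?Q * ?R) ^ 5 = (?P * ?Q) * ((?Q * ?R\<^sup>2) * (?Q * ?R) ^ 3)"
    by (simp add: eval_nat_numeral mult_ac)
  also have "fps_eq_upto N \<dots> (1 * (psi_sum N * (jacobi_sum N oo fps_X\<^sup>2)))"
    by (intro fps_eq_upto_mult partition_fps_qprod fps_eq_upto_sym[OF psi_sum_upto] jacobi_sum_compose_upto)
  finally show "five_dvd_upto N (?P * (?Q * ?R) ^ 5)"
    using five_dvd_upto_psi_jacobi by (simp add: five_dvd_upto_cong)
qed

text \<open>The other term of 4 F, namely E / R^2, for which (E R)^5 leaves E^3 (E R)^3.\<close>

lemma five_dvd_upto_partition_crank: "five_dvd_upto N (partition_fps * crank_sum N)"
proof (rule five_dvd_upto_cancel_qprod[of N _ N], fold qprod_minus_plus)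
  let ?P = partition_fps and ?Q = "qprod_minus N" and ?R = "qprod_plus N"
  have "?P * crank_sum N * (?Q * ?R) ^ 5 = (?P * ?Q) * (?Q * (crank_sum N * ?R\<^sup>2)) * (?Q * ?R) ^ 3"
    by (simp add: eval_nat_numeral mult_ac)
  also have "fps_eq_upto N \<dots> (1 * (?Q * ?Q\<^sup>2) * (jacobi_sum N oo fps_X\<^sup>2))"
    by (intro fps_eq_upto_mult partition_fps_qprod fps_eq_upto_refl crank_sum_upto jacobi_sum_compose_upto)
  also have "1 * (?Q * ?Q\<^sup>2) = ?Q ^ 3"
    by (simp add: eval_nat_numeral)
  also have "fps_eq_upto N (?Q ^ 3 * (jacobi_sum N oo fps_X\<^sup>2)) (jacobi_sum N * (jacobi_sum N oo fps_X\<^sup>2))"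
    by (intro fps_eq_upto_mult fps_eq_upto_refl fps_eq_upto_sym[OF jacobi_sum_upto])
  finally show "five_dvd_upto N (?P * crank_sum N * (?Q * ?R) ^ 5)"
    using five_dvd_upto_jacobi_jacobi by (simp add: five_dvd_upto_cong)
qed

section \<open>The signed count of unpaired parts as a coefficient\<close>

definition lambert_sum :: "nat \<Rightarrow> int fps" where
  "lambert_sum N = (\<Sum>k=1..N. fps_const (chi4 k) * (fps_X ^ k * alternating_fps k))"

lemma crank_sum_eq_lambert: "fps_eq_upto N (crank_sum N) (1 - 4 * lambert_sum N)"
  unfolding fps_eq_upto_def
proof (intro allI impI)
  fix M assume "M \<le> N"
  have "((-1) ^ k * (fps_X ^ triangle k * alternating_fps k)) $ M
      = - ((-1) ^ (k - 1) * (fps_X ^ triangle k * alternating_fps k) $ M)" if "k \<in> {1..N}" for k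
    using that by (cases k; cases "even k") auto
  then have "(\<Sum>k=1..N. (-1) ^ k * (fps_X ^ triangle k * alternating_fps k)) $ M = - lambert_sum N $ M"
    using lambert_rearrangement[OF \<open>M \<le> N\<close>]
    by (simp add: fps_sum_nth lambert_sum_def sum_negf)
  then show "crank_sum N $ M = (1 - 4 * lambert_sum N) $ M"
    by (simp add: crank_sum_def fps_numeral_mult_nth)
qed

lemma unpaired_diff:
  assumes p: "p \<in> integer_partitions N"
  shows "int (unpaired_count 1 p) - int (unpaired_count 3 p) = (\<Sum>k=1..N. if odd (count p k) then chi4 k else 0)"
proof -
  have *: "int (unpaired_count i p) = (\<Sum>k=1..N. if odd (count p k) \<and> k mod 4 = i then 1 else 0)"
    if "i < 4" for i
  proof -
    \<comment> \<open>An odd multiplicity is positive, so such a \<open>k\<close> is a part of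
      \<open>p\<close> and lies between 1 and \<open>N\<close>.\<close>
    have "{k \<in> unpaired_parts p. [k = i] (mod 4)} = {k \<in> {1..N}. odd (count p k) \<and> k mod 4 = i}"
      using that p part_le[OF p]
      by (auto simp: unpaired_parts_def cong_def integer_partitions_def Suc_le_eq intro!: gr0I
          intro: ccontr simp flip: count_greater_zero_iff)
    then show ?thesis
      by (simp add: unpaired_count_def sum.If_cases Int_def)
  qed
  show ?thesis
    by (subst *, simp, subst *, simp, unfold sum_subtractf[symmetric])
      (rule sum.cong, auto simp: chi4_def)
qed

text \<open>Double counting: for each \<open>k\<close>, the partitions in which it is unpaired are
  counted by \<open>odd_count_fps k\<close>, a multiple of \<open>partition_fps\<close>.\<close>

lemma sum_unpaired_diff:
  "(\<Sum>p\<in>integer_partitions N. int (unpaired_count 1 p) - int (unpaired_count 3 p))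
    = (partition_fps * lambert_sum N) $ N"
proof -
  have "(\<Sum>p\<in>integer_partitions N. int (unpaired_count 1 p) - int (unpaired_count 3 p))
      = (\<Sum>k=1..N. \<Sum>p\<in>integer_partitions N. if odd (count p k) then chi4 k else 0)"
    by (subst sum.swap) (simp only: unpaired_diff cong: sum.cong)
  also have "\<dots> = (\<Sum>k=1..N. chi4 k * odd_count_fps k $ N)"
    by (simp add: odd_count_fps_def sum.If_cases finite_integer_partitions Int_def mult.commute)
  also have "\<dots> = (\<Sum>k=1..N. (fps_const (chi4 k) * (partition_fps * (fps_X ^ k * alternating_fps k))) $ N)"
    by (simp add: odd_count_fps_eq)
  also have "\<dots> = (partition_fps * lambert_sum N) $ N"
    by (simp only: lambert_sum_def sum_distrib_left fps_sum_nth mult.left_commute)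
  finally show ?thesis .
qed

theorem theorem2p8:
  fixes n :: nat
  shows "[(\<Sum>p\<in>integer_partitions (5 * n + 4).
            int (unpaired_count 1 p) - int (unpaired_count 3 p)) = 0] (mod 5)"
proof -
  let ?N = "5 * n + 4"
  have "fps_eq_upto ?N (partition_fps * crank_sum ?N) (partition_fps - 4 * (partition_fps * lambert_sum ?N))"
    using fps_eq_upto_mult[OF fps_eq_upto_refl crank_sum_eq_lambert, of ?N partition_fps]
    by (simp add: algebra_simps)
  then have "five_dvd_upto ?N (partition_fps - 4 * (partition_fps * lambert_sum ?N))"
    using five_dvd_upto_partition_crank five_dvd_upto_cong by blast
  then have "5 dvd partition_fps $ ?N - 4 * (partition_fps * lambert_sum ?N) $ ?N"
    unfolding five_dvd_upto_def by (simp add: fps_numeral_mult_nth)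
  moreover have "5 dvd partition_fps $ ?N"
    using five_dvd_upto_partition_fps[of ?N] unfolding five_dvd_upto_def by simp
  \<comment> \<open>The factor 4 is invertible modulo 5.\<close>
  ultimately have "5 dvd (partition_fps * lambert_sum ?N) $ ?N"
    by presburger
  then show ?thesis
    unfolding sum_unpaired_diff cong_0_iff .
qed

end
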